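(* Let $G=(V,E)$ be a finite connected simple graph with a positive edge weight $w:E\to(0,\infty)$, and let $e\in E$. Then $$\sigma_e(w)\ge0.$$ Moreover, $\sigma_e(w)=0$ if and only if $\operatorname{girth}_G(e)\ge6$.
   Context: Graphs are finite, simple and undirected. For an edge $e$ of $G$, the local girth $\operatorname{girth}_G(e)$ is the minimum length of a cycle of $G$ containing $e$, with $\operatorname{girth}_G(e)=\infty$ if $e$ lies on no cycle. Lin--Lu--Yau curvature with fixed combinatorial distance: let $G=(V,E)$ be finite and connected, and let $d$ be its combinatorial (shortest-path) distance. For a positive edge weight $w:E\to(0,\infty)$ put $d_x^w:=\sum_{z\sim x}w_{xz}$. For $\alpha\in[0,1]$ and $x\in V$ let $\mu_x^{\alpha,w}$ be the probability measure on $V$ with $\mu_x^{\alpha,w}(x)=\alpha$, $\mu_x^{\alpha,w}(z)=(1-\alpha)w_{xz}/d_x^w$ if $z\sim x$, and $\mu_x^{\alpha,w}(z)=0$ otherwise. Let $W_1$ be the $1$-Wasserstein distance with respect to $d$ (independent of $w$). For an edge $e=xy$, put $\kappa_\alpha^w(x,y):=1-W_1(\mu_x^{\alpha,w},\mu_y^{\alpha,w})$ and $$\kappa_{\mathrm{LLY}}^w(e)=\kappa_{\mathrm{LLY}}^w(x,y):=\lim_{\alpha\to1^-}\frac{\kappa_\alpha^w(x,y)}{1-\alpha}.$$ For an edge $e=xy$, $q_e^w:=\frac{w_{xy}}{d_x^w}+\frac{w_{xy}}{d_y^w}$, and the short-cycle surplus is $\sigma_e(w):=\kappa_{\mathrm{LLY}}^w(e)-(2q_e^w-2)$.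 *)

theory Defs
  imports Complex_Main "HOL-Library.Extended_Nat"
begin

definition simple_graph :: "'a set \<Rightarrow> 'a set set \<Rightarrow> bool" where
  "simple_graph V E \<longleftrightarrow> finite V \<and> (\<forall>e\<in>E. e \<subseteq> V \<and> card e = 2)"

text \<open>Walks are nonempty vertex lists; a list of \<open>n + 1\<close> vertices is a walk of length \<open>n\<close>.\<close>

definition walk_betw :: "'a set \<Rightarrow> 'a set set \<Rightarrow> 'a \<Rightarrow> 'a list \<Rightarrow> 'a \<Rightarrow> bool" where
  "walk_betw V E u p v \<longleftrightarrow>
     p \<noteq> [] \<and> set p \<subseteq> V \<and> hd p = u \<and> last p = v \<and> successively (\<lambda>a b. {a, b} \<in> E) p"

definition connected_graph :: "'a set \<Rightarrow> 'a set set \<Rightarrow> bool" where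
  "connected_graph V E \<longleftrightarrow> V \<noteq> {} \<and> (\<forall>u\<in>V. \<forall>v\<in>V. \<exists>p. walk_betw V E u p v)"

definition graph_dist :: "'a set \<Rightarrow> 'a set set \<Rightarrow> 'a \<Rightarrow> 'a \<Rightarrow> nat" where
  "graph_dist V E u v = (LEAST n. \<exists>p. walk_betw V E u p v \<and> length p = Suc n)"

text \<open>A cycle is listed by its distinct vertices in cyclic order, without repeating the first one
  at the end, so its length is the length of the list.\<close>

definition cycle_edges :: "'a list \<Rightarrow> 'a set set" where
  "cycle_edges c = {{c ! i, c ! (Suc i mod length c)} |i. i < length c}"

definition is_cycle :: "'a set set \<Rightarrow> 'a list \<Rightarrow> bool" where
  "is_cycle E c \<longleftrightarrow> 3 \<le> length c \<and> distinct c \<and> cycle_edges c \<subseteq> E"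

text \<open>The infimum of the empty set in \<^typ>\<open>enat\<close> is \<open>\<infinity>\<close>, as required for an edge on no cycle.\<close>

definition local_girth :: "'a set set \<Rightarrow> 'a set \<Rightarrow> enat" where
  "local_girth E e = (INF c\<in>{c. is_cycle E c \<and> e \<in> cycle_edges c}. enat (length c))"

definition weighted_degree :: "'a set \<Rightarrow> 'a set set \<Rightarrow> ('a set \<Rightarrow> real) \<Rightarrow> 'a \<Rightarrow> real" where
  "weighted_degree V E w x = (\<Sum>z\<in>{z\<in>V. {x, z} \<in> E}. w {x, z})"

text \<open>Measures on the finite set \<open>V\<close> are given by their mass functions, and couplings by mass
  functions on \<open>V \<times> V\<close>; values outside \<open>V\<close> are irrelevant.\<close>

definition lazy_measure ::
  "'a set \<Rightarrow> 'a set set \<Rightarrow> ('a set \<Rightarrow> real) \<Rightarrow> real \<Rightarrow> 'a \<Rightarrow> 'a \<Rightarrow> real" where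
  "lazy_measure V E w \<alpha> x z =
     (if z = x then \<alpha>
      else if {x, z} \<in> E then (1 - \<alpha>) * w {x, z} / weighted_degree V E w x
      else 0)"

definition is_coupling ::
  "'a set \<Rightarrow> ('a \<Rightarrow> real) \<Rightarrow> ('a \<Rightarrow> real) \<Rightarrow> ('a \<Rightarrow> 'a \<Rightarrow> real) \<Rightarrow> bool" where
  "is_coupling V \<mu> \<nu> \<pi> \<longleftrightarrow>
     (\<forall>u\<in>V. \<forall>v\<in>V. 0 \<le> \<pi> u v) \<and>
     (\<forall>u\<in>V. (\<Sum>v\<in>V. \<pi> u v) = \<mu> u) \<and>
     (\<forall>v\<in>V. (\<Sum>u\<in>V. \<pi> u v) = \<nu> v)"

definition wasserstein1 ::
  "'a set \<Rightarrow> 'a set set \<Rightarrow> ('a \<Rightarrow> real) \<Rightarrow> ('a \<Rightarrow> real) \<Rightarrow> real" where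
  "wasserstein1 V E \<mu> \<nu> =
     (INF \<pi>\<in>{\<pi>. is_coupling V \<mu> \<nu> \<pi>}. \<Sum>u\<in>V. \<Sum>v\<in>V. real (graph_dist V E u v) * \<pi> u v)"

definition kappa ::
  "'a set \<Rightarrow> 'a set set \<Rightarrow> ('a set \<Rightarrow> real) \<Rightarrow> real \<Rightarrow> 'a \<Rightarrow> 'a \<Rightarrow> real" where
  "kappa V E w \<alpha> x y =
     1 - wasserstein1 V E (lazy_measure V E w \<alpha> x) (lazy_measure V E w \<alpha> y)"

definition kappa_LLY ::
  "'a set \<Rightarrow> 'a set set \<Rightarrow> ('a set \<Rightarrow> real) \<Rightarrow> 'a \<Rightarrow> 'a \<Rightarrow> real" where
  "kappa_LLY V E w x y = Lim (at_left 1) (\<lambda>\<alpha>. kappa V E w \<alpha> x y / (1 - \<alpha>))"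

definition edge_q ::
  "'a set \<Rightarrow> 'a set set \<Rightarrow> ('a set \<Rightarrow> real) \<Rightarrow> 'a \<Rightarrow> 'a \<Rightarrow> real" where
  "edge_q V E w x y = w {x, y} / weighted_degree V E w x + w {x, y} / weighted_degree V E w y"

definition short_cycle_surplus ::
  "'a set \<Rightarrow> 'a set set \<Rightarrow> ('a set \<Rightarrow> real) \<Rightarrow> 'a \<Rightarrow> 'a \<Rightarrow> real" where
  "short_cycle_surplus V E w x y = kappa_LLY V E w x y - (2 * edge_q V E w x y - 2)"

end

theory Submission
  imports Defs
begin

text \<open>
  Write \<open>p\<close> and \<open>q\<close> for the one-step distributions of the weighted random walk from \<open>x\<close> and
  from \<open>y\<close>, so that the lazy measures are \<open>\<alpha> \<delta>\<^sub>x + (1 - \<alpha>) p\<close> and \<open>\<alpha> \<delta>\<^sub>y + (1 - \<alpha>) q\<close>,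
  and \<open>q\<^sub>e = p(y) + q(x)\<close>.

  Mixing a coupling with the point mass at \<open>(x, y)\<close>, whose cost is \<open>1\<close>, shows that
  \<open>\<kappa>\<^sub>\<alpha> / (1 - \<alpha>)\<close> is nondecreasing in \<open>\<alpha>\<close> (\<open>kappa_quotient_mono\<close>). It is at most \<open>2\<close>, so the
  limit exists and is the supremum over \<open>[0, 1)\<close> (\<open>kappa_LLY_eq_SUP\<close>). Hence one good coupling
  at a single \<open>\<alpha>\<close> bounds the curvature from below, whereas an upper bound needs dual
  potentials for every \<open>\<alpha>\<close>.

  Lower bound (\<open>surplus_ge\<close>): at \<open>\<alpha> = 1/2\<close> send each neighbour's share of \<open>p\<close> to \<open>y\<close> and draw
  each neighbour's share of \<open>q\<close> from \<open>x\<close>. These routes have length at most \<open>2\<close>, and length \<open>0\<close>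
  for the share \<open>p(y)\<close>, which is already at \<open>y\<close>, and the share \<open>q(x)\<close>, which stays at \<open>x\<close>.
  The resulting bound is exactly \<open>2 q\<^sub>e - 2\<close>. If neighbours \<open>a \<noteq> y\<close> of \<open>x\<close> and \<open>b \<noteq> x\<close> of \<open>y\<close>
  are at distance at most \<open>2\<close>, a mass \<open>\<delta>\<close> can be rerouted from \<open>a \<rightarrow> y\<close>, \<open>x \<rightarrow> b\<close> (budget \<open>2 + 2\<close>)
  to \<open>a \<rightarrow> b\<close>, \<open>x \<rightarrow> y\<close> (budget \<open>2 + 1\<close>), which gains \<open>\<delta>\<close>.

  Upper bound (\<open>surplus_le_0\<close>): if no such pair exists, the potential with value \<open>-1\<close> at the other
  neighbours of \<open>x\<close>, \<open>0\<close> at \<open>x\<close>, \<open>1\<close> at \<open>y\<close> and \<open>2\<close> at the other neighbours of \<open>y\<close> grows no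
  faster than the distance between the two supports, and Kantorovich duality gives the
  matching bound.

  Finally, such a pair exists precisely when \<open>xy\<close> lies on a cycle of length \<open>3\<close>, \<open>4\<close> or \<open>5\<close>,
  according to \<open>d(a, b)\<close> being \<open>0\<close>, \<open>1\<close> or \<open>2\<close> in the generic case
  (\<open>local_girth_ge_6_iff\<close>).
\<close>

lemma sum_mult_of_bool_eq:
  fixes f :: "'b \<Rightarrow> real"
  assumes "finite A" "a \<in> A"
  shows "(\<Sum>u\<in>A. f u * of_bool (u = a)) = f a"
    and "(\<Sum>u\<in>A. of_bool (u = a) * f u) = f a"
    and "(\<Sum>u\<in>A. of_bool (u = a)) = (1 :: real)"
  using assms by (simp_all add: of_bool_def if_distrib[of "\<lambda>t. _ * t"] if_distrib[of "\<lambda>t. t * _"]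
      cong: if_cong)

section \<open>Short distances in a graph\<close>

lemma graph_dist_le:
  assumes "walk_betw V E u p v"
  shows "graph_dist V E u v \<le> length p - 1"
proof -
  have "p \<noteq> []" using assms by (simp add: walk_betw_def)
  then have "length p = Suc (length p - 1)" by (cases p) auto
  then show ?thesis unfolding graph_dist_def using assms by (intro Least_le) blast
qed

lemma shortest_walk_exists:
  assumes "connected_graph V E" "u \<in> V" "v \<in> V"
  obtains p where "walk_betw V E u p v" "length p = Suc (graph_dist V E u v)"
proof -
  obtain p where p: "walk_betw V E u p v" using assms by (auto simp: connected_graph_def)
  then have "p \<noteq> []" by (simp add: walk_betw_def)
  then have "length p = Suc (length p - 1)" by (cases p) auto
  with p have "\<exists>n p. walk_betw V E u p v \<and> length p = Suc n" by blast
  then have "\<exists>p. walk_betw V E u p v \<and> length p = Suc (graph_dist V E u v)"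
    unfolding graph_dist_def by (rule LeastI_ex)
  then show thesis using that by blast
qed

lemma graph_dist_self: "u \<in> V \<Longrightarrow> graph_dist V E u u = 0"
  using graph_dist_le[of V E u "[u]" u] by (simp add: walk_betw_def)

lemma graph_dist_edge:
  assumes "simple_graph V E" "{u, v} \<in> E"
  shows "graph_dist V E u v \<le> 1"
  using graph_dist_le[of V E u "[u, v]" v] assms by (auto simp: walk_betw_def simple_graph_def)

lemma graph_dist_two_edges:
  assumes "simple_graph V E" "{u, m} \<in> E" "{m, v} \<in> E"
  shows "graph_dist V E u v \<le> 2"
proof -
  have "{u, m} \<subseteq> V" "{m, v} \<subseteq> V" using assms unfolding simple_graph_def by blast+
  then show ?thesis using graph_dist_le[of V E u "[u, m, v]" v] assms by (auto simp: walk_betw_def)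
qed

lemma graph_dist_le_2D:
  assumes "connected_graph V E" "u \<in> V" "v \<in> V"
  shows "graph_dist V E u v = 0 \<Longrightarrow> u = v"
    and "graph_dist V E u v = 1 \<Longrightarrow> {u, v} \<in> E"
    and "graph_dist V E u v = 2 \<Longrightarrow> \<exists>m. {u, m} \<in> E \<and> {m, v} \<in> E"
proof -
  obtain p where "walk_betw V E u p v" "length p = Suc (graph_dist V E u v)"
    using shortest_walk_exists[OF assms] .
  then show "graph_dist V E u v = 0 \<Longrightarrow> u = v"
    and "graph_dist V E u v = 1 \<Longrightarrow> {u, v} \<in> E"
    and "graph_dist V E u v = 2 \<Longrightarrow> \<exists>m. {u, m} \<in> E \<and> {m, v} \<in> E"
    by (auto simp: walk_betw_def length_Suc_conv numeral_2_eq_2)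
qed

section \<open>Cycles of length at most five through an edge\<close>

lemma local_girth_ge_iff:
  "enat k \<le> local_girth E e \<longleftrightarrow> (\<forall>c. is_cycle E c \<longrightarrow> e \<in> cycle_edges c \<longrightarrow> k \<le> length c)"
  by (auto simp: local_girth_def le_INF_iff)

lemma cycle_edges_image: "cycle_edges c = (\<lambda>i. {c ! i, c ! (Suc i mod length c)}) ` {..<length c}"
  by (auto simp: cycle_edges_def)

lemma cycle_edges_3: "cycle_edges [a, b, c] = {{a, b}, {b, c}, {c, a}}"
  by (auto simp: cycle_edges_image lessThan_Suc)

lemma cycle_edges_4: "cycle_edges [a, b, c, d] = {{a, b}, {b, c}, {c, d}, {d, a}}"
  by (auto simp: cycle_edges_image lessThan_Suc)

lemma cycle_edges_5: "cycle_edges [a, b, c, d, f] = {{a, b}, {b, c}, {c, d}, {d, f}, {f, a}}"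
  by (auto simp: cycle_edges_image lessThan_Suc)

text \<open>The two endpoints of a path \<open>a x y b\<close> that closes up to a cycle of length at most \<open>5\<close>. The case
  \<open>a = b\<close> is included, so triangles count as well.\<close>

definition closing_pair :: "'a set \<Rightarrow> 'a set set \<Rightarrow> 'a \<Rightarrow> 'a \<Rightarrow> 'a \<Rightarrow> 'a \<Rightarrow> bool" where
  "closing_pair V E x y a b \<longleftrightarrow>
     {x, a} \<in> E \<and> a \<noteq> y \<and> {y, b} \<in> E \<and> b \<noteq> x \<and> graph_dist V E a b \<le> 2"

lemma closing_pairI:
  assumes "simple_graph V E" "{x, a} \<in> E" "a \<noteq> y" "{y, b} \<in> E" "b \<noteq> x"
    and "a = b \<or> {a, b} \<in> E \<or> (\<exists>m. {a, m} \<in> E \<and> {m, b} \<in> E)"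
  shows "closing_pair V E x y a b"
proof -
  have "a \<in> V" using assms(1,2) by (auto simp: simple_graph_def)
  then have "graph_dist V E a b \<le> 2"
    using assms(1,6) graph_dist_self[of a V E] graph_dist_edge[of V E a b]
      graph_dist_two_edges[of V E a _ b] by fastforce
  then show ?thesis using assms by (simp add: closing_pair_def)
qed

text \<open>The vertices before and after the edge on the cycle are at most two steps apart, walking around
  the rest of the cycle.\<close>

lemma short_cycle_imp_closing_pair:
  assumes G: "simple_graph V E" and c: "is_cycle E c" "{x, y} \<in> cycle_edges c" "length c < 6"
  shows "\<exists>a b. closing_pair V E x y a b"
proof -
  \<comment> \<open>Each cyclic position of the edge, and each orientation, is an instance of one rule per length.\<close>
  define Q where "Q u v \<longleftrightarrow> (\<exists>a b. closing_pair V E u v a b)" for u v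
  have Q_3: "Q u v" if "{u, a} \<in> E" "{a, v} \<in> E" "a \<noteq> v" "a \<noteq> u" for u v a
    using closing_pairI[OF G, of u a v a] that unfolding Q_def by (auto simp: insert_commute)
  have Q_4: "Q u v" if "{u, a} \<in> E" "{a, b} \<in> E" "{b, v} \<in> E" "a \<noteq> v" "b \<noteq> u" for u v a b
  proof -
    have "{v, b} \<in> E" using that by (simp add: insert_commute)
    then show ?thesis using closing_pairI[OF G, of u a v b] that unfolding Q_def by blast
  qed
  have Q_5: "Q u v" if "{u, a} \<in> E" "{a, m} \<in> E" "{m, b} \<in> E" "{b, v} \<in> E" "a \<noteq> v" "b \<noteq> u"
    for u v a m b
  proof -
    have "{v, b} \<in> E" using that by (simp add: insert_commute)
    then show ?thesis using closing_pairI[OF G, of u a v b] that unfolding Q_def by blast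
  qed
  consider "length c = 3" | "length c = 4" | "length c = 5"
    using c unfolding is_cycle_def by linarith
  then have "Q x y"
  proof cases
    case 1
    then obtain p q r where c_eq: "c = [p, q, r]"
      by (auto simp: numeral_eq_Suc length_Suc_conv)
    have E: "{p, q} \<in> E" "{q, r} \<in> E" "{r, p} \<in> E" and D: "distinct [p, q, r]"
      using c by (auto simp: c_eq is_cycle_def cycle_edges_3)
    have E': "{q, p} \<in> E" "{r, q} \<in> E" "{p, r} \<in> E" using E by (simp_all add: insert_commute)
    have "Q p q" "Q q p" "Q q r" "Q r q" "Q r p" "Q p r"
      using E E' D by (auto intro: Q_3)
    then show ?thesis using c(2) unfolding c_eq cycle_edges_3 by (auto simp: doubleton_eq_iff)
  next
    case 2
    then obtain p q r s where c_eq: "c = [p, q, r, s]"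
      by (auto simp: numeral_eq_Suc length_Suc_conv)
    have E: "{p, q} \<in> E" "{q, r} \<in> E" "{r, s} \<in> E" "{s, p} \<in> E" and D: "distinct [p, q, r, s]"
      using c by (auto simp: c_eq is_cycle_def cycle_edges_4)
    have E': "{q, p} \<in> E" "{r, q} \<in> E" "{s, r} \<in> E" "{p, s} \<in> E"
      using E by (simp_all add: insert_commute)
    have "Q p q" "Q q r" "Q r s" "Q s p" "Q q p" "Q r q" "Q s r" "Q p s"
      using Q_4[of p s r q] Q_4[of q p s r] Q_4[of r q p s] Q_4[of s r q p]
        Q_4[of q r s p] Q_4[of r s p q] Q_4[of s p q r] Q_4[of p q r s] E E' D by auto
    then show ?thesis using c(2) unfolding c_eq cycle_edges_4 by (auto simp: doubleton_eq_iff)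
  next
    case 3
    then obtain p q r s t where c_eq: "c = [p, q, r, s, t]"
      by (auto simp: numeral_eq_Suc length_Suc_conv)
    have E: "{p, q} \<in> E" "{q, r} \<in> E" "{r, s} \<in> E" "{s, t} \<in> E" "{t, p} \<in> E"
      and D: "distinct [p, q, r, s, t]"
      using c by (auto simp: c_eq is_cycle_def cycle_edges_5)
    have E': "{q, p} \<in> E" "{r, q} \<in> E" "{s, r} \<in> E" "{t, s} \<in> E" "{p, t} \<in> E"
      using E by (simp_all add: insert_commute)
    have "Q p q" "Q q r" "Q r s" "Q s t" "Q t p" "Q q p" "Q r q" "Q s r" "Q t s" "Q p t"
      using Q_5[of p t s r q] Q_5[of q p t s r] Q_5[of r q p t s] Q_5[of s r q p t]
        Q_5[of t s r q p] Q_5[of q r s t p] Q_5[of r s t p q] Q_5[of s t p q r]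
        Q_5[of t p q r s] Q_5[of p q r s t] E E' D by auto
    then show ?thesis using c(2) unfolding c_eq cycle_edges_5 by (auto simp: doubleton_eq_iff)
  qed
  then show ?thesis by (simp add: Q_def)
qed

text \<open>The closed walk from \<open>a\<close> to \<open>x\<close>, \<open>y\<close>, \<open>b\<close> and back along a geodesic can fail to be a cycle only
  if the middle vertex of the geodesic is \<open>x\<close> or \<open>y\<close>, or if \<open>a = b\<close>; then there is a triangle
  on \<open>xy\<close>.\<close>

lemma closing_pair_imp_short_cycle:
  assumes G: "simple_graph V E" "connected_graph V E" and e: "{x, y} \<in> E"
    and ab: "closing_pair V E x y a b"
  shows "\<exists>c. is_cycle E c \<and> {x, y} \<in> cycle_edges c \<and> length c < 6"
proof -
  have edges: "{x, a} \<in> E" "{y, b} \<in> E" and ne: "a \<noteq> y" "b \<noteq> x"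
    and dist: "graph_dist V E a b \<le> 2" using ab by (auto simp: closing_pair_def)
  have loopless: "u \<noteq> v" if "{u, v} \<in> E" for u v
    using that G(1) by (auto simp: simple_graph_def)
  have triangle: ?thesis if "{x, z} \<in> E" "{y, z} \<in> E" for z
    using that e loopless by (intro exI[of _ "[x, y, z]"])
      (auto simp: is_cycle_def cycle_edges_3 insert_commute)
  have V: "a \<in> V" "b \<in> V" using edges G(1) by (auto simp: simple_graph_def)
  have "graph_dist V E a b = 0 \<or> graph_dist V E a b = 1 \<or> graph_dist V E a b = 2"
    using dist by linarith
  then consider "a = b" | "{a, b} \<in> E" | m where "{a, m} \<in> E" "{m, b} \<in> E"
    using graph_dist_le_2D[OF G(2) V] by metis
  then show ?thesis
  proof cases
    case 1
    then show ?thesis using triangle edges by blast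
  next
    case 2
    then show ?thesis using edges e ne loopless by (intro exI[of _ "[x, y, b, a]"])
      (auto simp: is_cycle_def cycle_edges_4 insert_commute)
  next
    case 3
    consider "a = b" | "m = x" | "m = y" | "a \<noteq> b" "m \<noteq> x" "m \<noteq> y" by blast
    then show ?thesis
    proof cases
      case 4
      then show ?thesis using 3 edges e ne loopless by (intro exI[of _ "[x, y, b, m, a]"])
        (auto simp: is_cycle_def cycle_edges_5 insert_commute)
    qed (use triangle edges 3 in \<open>auto simp: insert_commute\<close>)
  qed
qed

lemma local_girth_ge_6_iff:
  assumes "simple_graph V E" "connected_graph V E" "{x, y} \<in> E"
  shows "6 \<le> local_girth E {x, y} \<longleftrightarrow> (\<forall>a b. \<not> closing_pair V E x y a b)"
  using local_girth_ge_iff[of 6 E "{x, y}"] short_cycle_imp_closing_pair[OF assms(1)]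
    closing_pair_imp_short_cycle[OF assms]
  by (auto simp: numeral_eq_enat not_le) (meson not_le)+

section \<open>Couplings and weak Kantorovich duality\<close>

definition transport_cost ::
  "'a set \<Rightarrow> 'a set set \<Rightarrow> ('a \<Rightarrow> 'a \<Rightarrow> real) \<Rightarrow> real" where
  "transport_cost V E \<pi> = (\<Sum>u\<in>V. \<Sum>v\<in>V. real (graph_dist V E u v) * \<pi> u v)"

lemma wasserstein1_le:
  assumes "is_coupling V \<mu> \<nu> \<pi>"
  shows "wasserstein1 V E \<mu> \<nu> \<le> transport_cost V E \<pi>"
  unfolding wasserstein1_def transport_cost_def using assms
  by (intro cINF_lower bdd_belowI[of _ 0]) (auto simp: is_coupling_def intro!: sum_nonneg)

lemma wasserstein1_ge:
  assumes "is_coupling V \<mu> \<nu> \<pi>\<^sub>0"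
    and "\<And>\<pi>. is_coupling V \<mu> \<nu> \<pi> \<Longrightarrow> K \<le> transport_cost V E \<pi>"
  shows "K \<le> wasserstein1 V E \<mu> \<nu>"
  unfolding wasserstein1_def using assms
  by (intro cINF_greatest) (auto simp: transport_cost_def)

lemma product_coupling:
  assumes "\<And>u. u \<in> V \<Longrightarrow> 0 \<le> \<mu> u" "\<And>v. v \<in> V \<Longrightarrow> 0 \<le> \<nu> v" "sum \<mu> V = 1" "sum \<nu> V = 1"
  shows "is_coupling V \<mu> \<nu> (\<lambda>u v. \<mu> u * \<nu> v)"
  using assms by (simp add: is_coupling_def flip: sum_distrib_left sum_distrib_right)

lemma coupling_zero:
  assumes "finite V" "is_coupling V \<mu> \<nu> \<pi>" "u \<in> V" "v \<in> V" "\<mu> u = 0 \<or> \<nu> v = 0"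
  shows "\<pi> u v = 0"
  using assms sum_nonneg_eq_0_iff[of V "\<lambda>v. \<pi> u v"] sum_nonneg_eq_0_iff[of V "\<lambda>u. \<pi> u v"]
  unfolding is_coupling_def by metis

text \<open>The easy half of Kantorovich duality. The source and the target potential are separate and
  constrained only on the supports, which replaces the extension of a Lipschitz function to the
  whole of \<open>V\<close>.\<close>

lemma transport_cost_ge_dual:
  assumes fin: "finite V" and \<pi>: "is_coupling V \<mu> \<nu> \<pi>"
    and dual: "\<And>u v. \<lbrakk>u \<in> V; v \<in> V; \<mu> u \<noteq> 0; \<nu> v \<noteq> 0\<rbrakk>
                 \<Longrightarrow> \<psi> v - \<phi> u \<le> real (graph_dist V E u v)"
  shows "(\<Sum>v\<in>V. \<psi> v * \<nu> v) - (\<Sum>u\<in>V. \<phi> u * \<mu> u) \<le> transport_cost V E \<pi>"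
proof -
  have "(\<Sum>v\<in>V. \<psi> v * \<nu> v) = (\<Sum>v\<in>V. \<Sum>u\<in>V. \<psi> v * \<pi> u v)"
    using \<pi> by (simp add: is_coupling_def flip: sum_distrib_left)
  also have "\<dots> = (\<Sum>u\<in>V. \<Sum>v\<in>V. \<psi> v * \<pi> u v)" by (rule sum.swap)
  finally have 1: "(\<Sum>v\<in>V. \<psi> v * \<nu> v) = (\<Sum>u\<in>V. \<Sum>v\<in>V. \<psi> v * \<pi> u v)" .
  have 2: "(\<Sum>u\<in>V. \<phi> u * \<mu> u) = (\<Sum>u\<in>V. \<Sum>v\<in>V. \<phi> u * \<pi> u v)"
    using \<pi> by (simp add: is_coupling_def flip: sum_distrib_left)
  have "(\<psi> v - \<phi> u) * \<pi> u v \<le> real (graph_dist V E u v) * \<pi> u v" if "u \<in> V" "v \<in> V" for u v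
  proof (cases "\<mu> u = 0 \<or> \<nu> v = 0")
    case True
    then show ?thesis using coupling_zero[OF fin \<pi> that] by simp
  next
    case False
    then show ?thesis using dual that \<pi> by (intro mult_right_mono) (auto simp: is_coupling_def)
  qed
  then show ?thesis unfolding 1 2 transport_cost_def sum_subtractf[symmetric] left_diff_distrib[symmetric]
    by (intro sum_mono) auto
qed

section \<open>The lazy random walks at the ends of an edge\<close>

text \<open>The endpoints are ordered because they play the roles of source and target.\<close>

locale weighted_edge =
  fixes V :: "'a set" and E :: "'a set set" and w :: "'a set \<Rightarrow> real" and x y :: 'a
  assumes simple: "simple_graph V E" and connected: "connected_graph V E"
    and weight_pos: "f \<in> E \<Longrightarrow> 0 < w f" and edge: "{x, y} \<in> E"
begin

definition step :: "'a \<Rightarrow> 'a \<Rightarrow> real" where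
  "step u v = (if {u, v} \<in> E then w {u, v} / weighted_degree V E w u else 0)"

abbreviation lazy_wasserstein :: "real \<Rightarrow> real" where
  "lazy_wasserstein \<alpha> \<equiv> wasserstein1 V E (lazy_measure V E w \<alpha> x) (lazy_measure V E w \<alpha> y)"

lemma finite_V: "finite V" using simple by (simp add: simple_graph_def)

lemma edge_in_V: "{u, v} \<in> E \<Longrightarrow> u \<in> V \<and> v \<in> V"
  using simple by (auto simp: simple_graph_def)

lemma loopless: "{u, v} \<in> E \<Longrightarrow> u \<noteq> v"
  using simple by (auto simp: simple_graph_def)

lemma endpoints: "x \<in> V" "y \<in> V" "x \<noteq> y" "{y, x} \<in> E" "graph_dist V E x y \<le> 1"
  using edge_in_V[OF edge] loopless[OF edge] edge graph_dist_edge[OF simple edge]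
  by (auto simp: insert_commute)

lemma weighted_degree_pos: "{u, v} \<in> E \<Longrightarrow> 0 < weighted_degree V E w u"
  unfolding weighted_degree_def using finite_V edge_in_V weight_pos
  by (intro sum_pos) auto

lemma step_nonneg: "0 \<le> step u v"
  using weight_pos weighted_degree_pos by (auto simp: step_def less_imp_le)

lemma step_self: "step u u = 0"
  using loopless[of u u] by (auto simp: step_def)

lemma step_pos_iff: "0 < step u v \<longleftrightarrow> {u, v} \<in> E"
  using weight_pos weighted_degree_pos by (auto simp: step_def)

lemma step_nonzeroD: "step u v \<noteq> 0 \<Longrightarrow> {u, v} \<in> E"
  by (auto simp: step_def split: if_splits)

lemma sum_step:
  assumes "{u, v} \<in> E"
  shows "(\<Sum>z\<in>V. step u z) = 1"
proof -
  have "(\<Sum>z\<in>V. step u z) = (\<Sum>z\<in>{z\<in>V. {u, z} \<in> E}. w {u, z} / weighted_degree V E w u)"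
    unfolding step_def using finite_V by (simp add: sum.inter_filter)
  also have "\<dots> = 1"
    using weighted_degree_pos[OF assms] by (simp add: weighted_degree_def flip: sum_divide_distrib)
  finally show ?thesis .
qed

lemmas sum_step_x = sum_step[OF edge] and sum_step_y = sum_step[OF endpoints(4)]

lemma lazy_measure_eq: "lazy_measure V E w \<alpha> u v = \<alpha> * of_bool (v = u) + (1 - \<alpha>) * step u v"
  using loopless[of u u] by (auto simp: lazy_measure_def step_def)

lemma sum_lazy_measure:
  assumes "{u, v} \<in> E"
  shows "(\<Sum>z\<in>V. f z * lazy_measure V E w \<alpha> u z) = \<alpha> * f u + (1 - \<alpha>) * (\<Sum>z\<in>V. f z * step u z)"
proof -
  have "(\<Sum>z\<in>V. f z * lazy_measure V E w \<alpha> u z)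
      = \<alpha> * (\<Sum>z\<in>V. f z * of_bool (z = u)) + (1 - \<alpha>) * (\<Sum>z\<in>V. f z * step u z)"
    unfolding lazy_measure_eq sum_distrib_left sum.distrib[symmetric]
    by (intro sum.cong) (auto simp: algebra_simps)
  then show ?thesis using sum_mult_of_bool_eq(1)[OF finite_V, of u f] edge_in_V[OF assms] by simp
qed

lemma lazy_measure_nonzeroD: "lazy_measure V E w \<alpha> u v \<noteq> 0 \<Longrightarrow> v = u \<or> {u, v} \<in> E"
  by (auto simp: lazy_measure_def split: if_splits)

lemma lazy_coupling_exists:
  assumes "0 \<le> \<alpha>" "\<alpha> \<le> 1"
  shows "\<exists>\<pi>. is_coupling V (lazy_measure V E w \<alpha> x) (lazy_measure V E w \<alpha> y) \<pi>"
proof -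
  have "0 \<le> lazy_measure V E w \<alpha> u v" for u v
    using assms step_nonneg by (simp add: lazy_measure_eq)
  moreover have "sum (lazy_measure V E w \<alpha> u) V = 1" if "{u, v} \<in> E" for u v
    using sum_lazy_measure[OF that, of "\<lambda>_. 1"] sum_step[OF that] by simp
  ultimately show ?thesis using product_coupling edge endpoints(4) by metis
qed

text \<open>Whatever \<open>\<alpha>\<close> is, the lazy measures live on the closed neighbourhoods of \<open>x\<close> and \<open>y\<close>, so
  one pair of potentials bounds all of them at once.\<close>

lemma lazy_wasserstein_ge_dual:
  assumes "0 \<le> \<alpha>" "\<alpha> \<le> 1"
    and dual: "\<And>u v. \<lbrakk>u = x \<or> {x, u} \<in> E; v = y \<or> {y, v} \<in> E\<rbrakk>
                 \<Longrightarrow> \<psi> v - \<phi> u \<le> real (graph_dist V E u v)"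
  shows "\<alpha> * (\<psi> y - \<phi> x) + (1 - \<alpha>) * ((\<Sum>v\<in>V. \<psi> v * step y v) - (\<Sum>u\<in>V. \<phi> u * step x u))
           \<le> lazy_wasserstein \<alpha>"
proof -
  obtain \<pi>\<^sub>0 where \<pi>\<^sub>0: "is_coupling V (lazy_measure V E w \<alpha> x) (lazy_measure V E w \<alpha> y) \<pi>\<^sub>0"
    using lazy_coupling_exists[OF assms(1,2)] by blast
  show ?thesis
  proof (rule wasserstein1_ge[OF \<pi>\<^sub>0])
    fix \<pi> assume \<pi>: "is_coupling V (lazy_measure V E w \<alpha> x) (lazy_measure V E w \<alpha> y) \<pi>"
    have "(\<Sum>v\<in>V. \<psi> v * lazy_measure V E w \<alpha> y v) - (\<Sum>u\<in>V. \<phi> u * lazy_measure V E w \<alpha> x u)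
            \<le> transport_cost V E \<pi>"
      by (rule transport_cost_ge_dual[OF finite_V \<pi> dual]) (auto dest: lazy_measure_nonzeroD)
    then show "\<alpha> * (\<psi> y - \<phi> x)
        + (1 - \<alpha>) * ((\<Sum>v\<in>V. \<psi> v * step y v) - (\<Sum>u\<in>V. \<phi> u * step x u)) \<le> transport_cost V E \<pi>"
      unfolding sum_lazy_measure[OF edge] sum_lazy_measure[OF endpoints(4)] by (simp add: algebra_simps)
  qed
qed

section \<open>The Lin--Lu--Yau curvature as a supremum\<close>

text \<open>With \<open>t = (1 - \<beta>) / (1 - \<alpha>)\<close>, the lazy measure for \<open>\<beta>\<close> is the mixture of the point mass and of
  the lazy measure for \<open>\<alpha>\<close> with weights \<open>1 - t\<close> and \<open>t\<close>. Couplings mix in the same way, and the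
  point masses are transported at cost \<open>d(x, y) \<le> 1\<close>.\<close>

lemma kappa_quotient_mono:
  assumes "0 \<le> \<alpha>" "\<alpha> \<le> \<beta>" "\<beta> < 1"
  shows "kappa V E w \<alpha> x y / (1 - \<alpha>) \<le> kappa V E w \<beta> x y / (1 - \<beta>)"
proof -
  define t where "t = (1 - \<beta>) / (1 - \<alpha>)"
  have t: "0 < t" "t \<le> 1" "t * (1 - \<alpha>) = 1 - \<beta>" using assms by (auto simp: t_def)
  obtain \<pi>\<^sub>0 where \<pi>\<^sub>0: "is_coupling V (lazy_measure V E w \<alpha> x) (lazy_measure V E w \<alpha> y) \<pi>\<^sub>0"
    using lazy_coupling_exists assms by fastforce
  have "(lazy_wasserstein \<beta> - (1 - t)) / t \<le> lazy_wasserstein \<alpha>"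
  proof (rule wasserstein1_ge[OF \<pi>\<^sub>0])
    fix \<pi> assume \<pi>: "is_coupling V (lazy_measure V E w \<alpha> x) (lazy_measure V E w \<alpha> y) \<pi>"
    define \<rho> where "\<rho> u v = (1 - t) * (of_bool (u = x) * of_bool (v = y)) + t * \<pi> u v" for u v
    have mix: "lazy_measure V E w \<beta> u v = (1 - t) * of_bool (v = u) + t * lazy_measure V E w \<alpha> u v"
      for u v
    proof -
      have "\<beta> = (1 - t) + t * \<alpha>" using t(3) by (simp add: algebra_simps)
      moreover have "t * ((1 - \<alpha>) * step u v) = (1 - \<beta>) * step u v"
        using t(3) by (metis mult.assoc)
      ultimately show ?thesis by (simp add: lazy_measure_eq algebra_simps)
    qed
    have "is_coupling V (lazy_measure V E w \<beta> x) (lazy_measure V E w \<beta> y) \<rho>"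
      using \<pi> t endpoints finite_V unfolding is_coupling_def \<rho>_def mix
      by (simp add: sum.distrib sum_mult_of_bool_eq flip: sum_distrib_left sum_distrib_right)
    then have "lazy_wasserstein \<beta> \<le> transport_cost V E \<rho>" by (rule wasserstein1_le)
    also have "transport_cost V E \<rho> =
        (1 - t) * (\<Sum>u\<in>V. of_bool (u = x) * (\<Sum>v\<in>V. of_bool (v = y) * real (graph_dist V E u v)))
        + t * transport_cost V E \<pi>"
      unfolding transport_cost_def \<rho>_def sum_distrib_left sum.distrib[symmetric]
      by (intro sum.cong) (auto simp: algebra_simps)
    also have "\<dots> = (1 - t) * graph_dist V E x y + t * transport_cost V E \<pi>"
      by (simp add: sum_mult_of_bool_eq finite_V endpoints)
    also have "\<dots> \<le> (1 - t) + t * transport_cost V E \<pi>"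
      using t endpoints(5) mult_left_mono[of "real (graph_dist V E x y)" 1 "1 - t"] by simp
    finally show "(lazy_wasserstein \<beta> - (1 - t)) / t \<le> transport_cost V E \<pi>"
      using t by (simp add: pos_divide_le_eq algebra_simps)
  qed
  then have "lazy_wasserstein \<beta> \<le> (1 - t) + t * lazy_wasserstein \<alpha>"
    using t by (simp add: pos_divide_le_eq algebra_simps)
  then have "t * kappa V E w \<alpha> x y \<le> kappa V E w \<beta> x y"
    unfolding kappa_def by (simp add: algebra_simps)
  then have "t * kappa V E w \<alpha> x y / (1 - \<beta>) \<le> kappa V E w \<beta> x y / (1 - \<beta>)"
    using assms by (intro divide_right_mono) auto
  then show ?thesis using t assms by (simp add: t_def)
qed

text \<open>Counting only the mass that must leave \<open>x\<close> for \<open>y\<close>: all but \<open>1 - \<alpha>\<close> of the source mass is at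
  \<open>x\<close>, and at least \<open>\<alpha>\<close> must arrive at \<open>y\<close>, so at least \<open>2 \<alpha> - 1\<close> travels from \<open>x\<close> to \<open>y\<close>. The
  two indicator-type potentials express this as a dual bound.\<close>

lemma kappa_quotient_le_2:
  assumes "0 \<le> \<alpha>" "\<alpha> < 1"
  shows "kappa V E w \<alpha> x y / (1 - \<alpha>) \<le> 2"
proof -
  define \<psi> :: "'a \<Rightarrow> real" where "\<psi> = (\<lambda>v. of_bool (v = y))"
  define \<phi> :: "'a \<Rightarrow> real" where "\<phi> = (\<lambda>u. 1 - of_bool (u = x))"
  have "graph_dist V E x y \<noteq> 0" using graph_dist_le_2D(1)[OF connected endpoints(1,2)] endpoints(3) by blast
  then have "\<alpha> * (\<psi> y - \<phi> x) + (1 - \<alpha>) * ((\<Sum>v\<in>V. \<psi> v * step y v) - (\<Sum>u\<in>V. \<phi> u * step x u))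
          \<le> lazy_wasserstein \<alpha>"
    using assms by (intro lazy_wasserstein_ge_dual) (auto simp: \<phi>_def \<psi>_def of_bool_def)
  moreover have "(\<Sum>v\<in>V. \<psi> v * step y v) = 0"
    using sum_mult_of_bool_eq(2)[OF finite_V endpoints(2)] by (simp add: \<psi>_def step_self)
  moreover have "(\<Sum>u\<in>V. \<phi> u * step x u) = 1"
    using sum_mult_of_bool_eq(2)[OF finite_V endpoints(1)]
    by (simp add: \<phi>_def left_diff_distrib sum_subtractf sum_step_x step_self)
  ultimately have "\<alpha> - (1 - \<alpha>) \<le> lazy_wasserstein \<alpha>" by (simp add: \<phi>_def \<psi>_def)
  then show ?thesis using assms by (simp add: kappa_def pos_divide_le_eq)
qed

lemma kappa_quotient_tendsto:
  "((\<lambda>\<alpha>. kappa V E w \<alpha> x y / (1 - \<alpha>)) \<longlongrightarrow>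
     (SUP \<alpha>\<in>{0..<1}. kappa V E w \<alpha> x y / (1 - \<alpha>))) (at_left 1)"
proof -
  let ?F = "\<lambda>\<alpha>. kappa V E w \<alpha> x y / (1 - \<alpha>)"
  have bdd: "bdd_above (?F ` {0..<1})"
    using kappa_quotient_le_2 by (intro bdd_aboveI[of _ 2]) auto
  show ?thesis
  proof (rule order_tendstoI)
    fix a assume "a < (SUP \<alpha>\<in>{0..<1}. ?F \<alpha>)"
    then obtain \<beta> where \<beta>: "\<beta> \<in> {0..<1}" "a < ?F \<beta>"
      using less_cSUP_iff[OF _ bdd] by fastforce
    then have "eventually (\<lambda>\<alpha>. \<alpha> \<in> {\<beta><..<1}) (at_left 1)"
      by (intro eventually_at_left_real) auto
    then show "eventually (\<lambda>\<alpha>. a < ?F \<alpha>) (at_left 1)"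
      by eventually_elim (use \<beta> in \<open>auto intro!: less_le_trans[OF \<beta>(2) kappa_quotient_mono]\<close>)
  next
    fix a assume a: "(SUP \<alpha>\<in>{0..<1}. ?F \<alpha>) < a"
    have "eventually (\<lambda>\<alpha>::real. \<alpha> \<in> {0<..<1}) (at_left 1)"
      by (intro eventually_at_left_real) auto
    then show "eventually (\<lambda>\<alpha>. ?F \<alpha> < a) (at_left 1)"
      by eventually_elim (auto intro: le_less_trans[OF cSUP_upper[OF _ bdd] a])
  qed
qed

lemma kappa_LLY_eq_SUP:
  "kappa_LLY V E w x y = (SUP \<alpha>\<in>{0..<1}. kappa V E w \<alpha> x y / (1 - \<alpha>))"
  unfolding kappa_LLY_def by (rule tendsto_Lim[OF _ kappa_quotient_tendsto]) simp

lemma kappa_quotient_le_kappa_LLY: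
  assumes "0 \<le> \<alpha>" "\<alpha> < 1"
  shows "kappa V E w \<alpha> x y / (1 - \<alpha>) \<le> kappa_LLY V E w x y"
  unfolding kappa_LLY_eq_SUP using assms kappa_quotient_le_2
  by (intro cSUP_upper bdd_aboveI[of _ 2]) auto

lemma kappa_LLY_leI:
  assumes "\<And>\<alpha>. \<lbrakk>0 \<le> \<alpha>; \<alpha> < 1\<rbrakk> \<Longrightarrow> kappa V E w \<alpha> x y / (1 - \<alpha>) \<le> K"
  shows "kappa_LLY V E w x y \<le> K"
  unfolding kappa_LLY_eq_SUP using assms by (intro cSUP_least) auto

section \<open>The short-cycle surplus\<close>

lemma edge_q_eq: "edge_q V E w x y = step x y + step y x"
  using edge endpoints(4) by (simp add: edge_q_def step_def insert_commute)

text \<open>The rerouting term of the coupling is a product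
  of two differences of point masses, so it has zero marginals; \<open>\<delta> = 0\<close> is admitted together
  with the degenerate choice \<open>a = y\<close>, \<open>b = x\<close>, which makes nonnegativity of the surplus an
  instance.\<close>

lemma surplus_ge:
  assumes a: "{x, a} \<in> E" and b: "{y, b} \<in> E" and dist: "graph_dist V E a b \<le> 2"
    and \<delta>: "0 \<le> \<delta>" "\<delta> \<le> step x a" "\<delta> \<le> step y b" "\<delta> \<noteq> 0 \<Longrightarrow> a \<noteq> y \<and> b \<noteq> x"
  shows "\<delta> \<le> short_cycle_surplus V E w x y"
proof -
  let ?I = "\<lambda>s t :: 'a. of_bool (s = t) :: real"
  \<comment> \<open>Twice the coupling: its marginals are \<open>\<delta>\<^sub>x + p\<close> and \<open>\<delta>\<^sub>y + q\<close>.\<close>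
  define \<rho> where
    "\<rho> u v = step x u * ?I v y + ?I u x * step y v + \<delta> * ((?I u a - ?I u x) * (?I v b - ?I v y))" for u v
  \<comment> \<open>The budget of each route. It dominates the distance on the support of \<open>\<rho>\<close>, and makes the
     cost computable even if \<open>a\<close> is adjacent to \<open>y\<close> or \<open>b\<close> to \<open>x\<close>.\<close>
  define D :: "'a \<Rightarrow> 'a \<Rightarrow> real" where
    "D u v = (if u = v \<and> u \<in> {x, y} then 0 else if u = x \<and> v = y then 1 else 2)" for u v
  have ab: "a \<in> V" "b \<in> V" "a \<noteq> x" "b \<noteq> y"
    using edge_in_V[OF a] edge_in_V[OF b] loopless[OF a] loopless[OF b] by auto
  note pick = sum_mult_of_bool_eq[OF finite_V]
  have nonneg: "0 \<le> \<rho> u v" for u v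
    using step_nonneg[of x u] step_nonneg[of y v] \<delta>(1-3) ab endpoints(3) step_nonneg[of y y] step_nonneg[of x x]
    by (auto simp: \<rho>_def of_bool_def)
  have row: "(\<Sum>v\<in>V. \<rho> u v) = ?I u x + step x u" for u
    by (simp add: \<rho>_def sum.distrib sum_subtractf pick ab endpoints sum_step_y flip: sum_distrib_left)
  have col: "(\<Sum>u\<in>V. \<rho> u v) = ?I v y + step y v" for v
    by (simp add: \<rho>_def sum.distrib sum_subtractf pick ab endpoints sum_step_x
        flip: sum_distrib_left sum_distrib_right)
  have coupling: "is_coupling V (lazy_measure V E w (1/2) x) (lazy_measure V E w (1/2) y)
      (\<lambda>u v. \<rho> u v / 2)"
    using nonneg row col by (simp add: is_coupling_def lazy_measure_eq flip: sum_divide_distrib)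
  have dist_le: "real (graph_dist V E u v) * \<rho> u v \<le> D u v * \<rho> u v" for u v
  proof (cases "\<rho> u v = 0")
    case False
    then have "(v = y \<and> {x, u} \<in> E) \<or> (u = x \<and> {y, v} \<in> E) \<or> (u = a \<and> v = b) \<or> (u = x \<and> v = y)"
      using step_nonzeroD[of x u] step_nonzeroD[of y v] a b by (auto simp: \<rho>_def of_bool_def split: if_splits)
    then have "real (graph_dist V E u v) \<le> D u v"
    proof (elim disjE conjE)
      assume "v = y" "{x, u} \<in> E"
      then show ?thesis using graph_dist_two_edges[OF simple _ edge, of u] loopless[of x u]
          graph_dist_self[OF endpoints(2), of E] by (auto simp: D_def insert_commute)
    next
      assume "u = x" "{y, v} \<in> E"
      then show ?thesis using graph_dist_two_edges[OF simple edge, of v] loopless[of y v]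
          graph_dist_self[OF endpoints(1), of E] by (auto simp: D_def insert_commute)
    next
      assume "u = a" "v = b"
      then show ?thesis using dist ab endpoints graph_dist_self[of a V E] by (auto simp: D_def)
    next
      assume "u = x" "v = y"
      then show ?thesis using endpoints by (auto simp: D_def)
    qed
    then show ?thesis using nonneg by (intro mult_right_mono)
  qed simp
  have "transport_cost V E (\<lambda>u v. \<rho> u v / 2) \<le> (\<Sum>u\<in>V. \<Sum>v\<in>V. D u v * \<rho> u v) / 2"
    unfolding transport_cost_def sum_divide_distrib
    using dist_le by (intro sum_mono) (simp add: field_simps)
  also have "(\<Sum>u\<in>V. \<Sum>v\<in>V. D u v * \<rho> u v) =
      (\<Sum>u\<in>V. step x u * D u y) + (\<Sum>v\<in>V. D x v * step y v) + \<delta> * (D a b - D a y - D x b + D x y)"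
  proof -
    have "(\<Sum>v\<in>V. D u v * \<rho> u v) = step x u * D u y + ?I u x * (\<Sum>v\<in>V. D u v * step y v)
        + \<delta> * ((?I u a - ?I u x) * (D u b - D u y))" for u
    proof -
      have "(\<Sum>v\<in>V. D u v * \<rho> u v) = step x u * (\<Sum>v\<in>V. D u v * ?I v y)
        + ?I u x * (\<Sum>v\<in>V. D u v * step y v)
        + \<delta> * ((?I u a - ?I u x) * ((\<Sum>v\<in>V. D u v * ?I v b) - (\<Sum>v\<in>V. D u v * ?I v y)))"
        unfolding \<rho>_def sum_distrib_left sum_subtractf[symmetric] sum.distrib[symmetric]
        by (intro sum.cong) (auto simp: algebra_simps)
      then show ?thesis by (simp add: pick ab endpoints)
    qed
    then have "(\<Sum>u\<in>V. \<Sum>v\<in>V. D u v * \<rho> u v) = (\<Sum>u\<in>V. step x u * D u y)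
       + (\<Sum>u\<in>V. ?I u x * (\<Sum>v\<in>V. D u v * step y v))
       + \<delta> * ((\<Sum>u\<in>V. ?I u a * (D u b - D u y)) - (\<Sum>u\<in>V. ?I u x * (D u b - D u y)))"
      by (simp add: sum.distrib left_diff_distrib sum_subtractf flip: sum_distrib_left)
    then show ?thesis unfolding pick(2)[OF ab(1)] pick(2)[OF endpoints(1)] by (simp add: algebra_simps)
  qed
  also have "(\<Sum>u\<in>V. step x u * D u y) = 2 - 2 * step x y"
  proof -
    have "step x u * D u y = 2 * step x u - 2 * (step x u * ?I u y)" for u
      using endpoints(3) by (auto simp: D_def step_self of_bool_def)
    then show ?thesis by (simp add: sum_subtractf pick endpoints sum_step_x flip: sum_distrib_left)
  qed
  also have "(\<Sum>v\<in>V. D x v * step y v) = 2 - 2 * step y x"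
  proof -
    have "D x v * step y v = 2 * step y v - 2 * (step y v * ?I v x)" for v
      using endpoints(3) by (auto simp: D_def step_self of_bool_def)
    then show ?thesis by (simp add: sum_subtractf pick endpoints sum_step_y flip: sum_distrib_left)
  qed
  also have "\<delta> * (D a b - D a y - D x b + D x y) \<le> - \<delta>"
  proof (cases "\<delta> = 0")
    case False
    then have "D a b \<le> 2" "D a y = 2" "D x b = 2" "D x y = 1"
      using \<delta>(4) ab endpoints by (auto simp: D_def)
    then show ?thesis using \<delta>(1) mult_left_mono[of "D a b - D a y - D x b + D x y" "-1" \<delta>] by simp
  qed simp
  finally have "lazy_wasserstein (1/2) \<le> (2 - 2 * step x y + (2 - 2 * step y x) + - \<delta>) / 2"
    using wasserstein1_le[OF coupling, of E] by simp
  then have "2 * edge_q V E w x y - 2 + \<delta> \<le> kappa V E w (1/2) x y / (1 - 1/2)"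
    by (simp add: kappa_def edge_q_eq)
  also have "\<dots> \<le> kappa_LLY V E w x y" by (rule kappa_quotient_le_kappa_LLY) auto
  finally show ?thesis by (simp add: short_cycle_surplus_def)
qed

text \<open>The potentials agree with the values \<open>-1, 0, 1, 2\<close> along every path \<open>a x y b\<close>. Without a
  closing pair there are no common neighbours of \<open>x\<close> and \<open>y\<close>, so the distances from \<open>x\<close> to \<open>b\<close>
  and from \<open>a\<close> to \<open>y\<close> are at least \<open>2\<close>, and those from \<open>a\<close> to \<open>b\<close> at least \<open>3\<close>.\<close>

lemma surplus_le_0:
  assumes no_pair: "\<And>a b. \<not> closing_pair V E x y a b"
  shows "short_cycle_surplus V E w x y \<le> 0"
proof -
  define \<phi> :: "'a \<Rightarrow> real" where "\<phi> u = (if u = x then 0 else if u = y then 1 else - 1)" for u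
  define \<psi> :: "'a \<Rightarrow> real" where "\<psi> v = (if v = y then 1 else if v = x then 0 else 2)" for v
  have no_triangle: "\<not> ({x, z} \<in> E \<and> {y, z} \<in> E)" for z
    using no_pair[of z z] closing_pairI[OF simple, of x z y z] loopless[of x z] loopless[of y z] by blast
  have far: "2 < graph_dist V E u v" if "{x, u} \<in> E" "u \<noteq> y" "{y, v} \<in> E" "v \<noteq> x" for u v
    using no_pair[of u v] that by (simp add: closing_pair_def)
  have dual: "\<psi> v - \<phi> u \<le> real (graph_dist V E u v)"
    if u: "u = x \<or> {x, u} \<in> E" and v: "v = y \<or> {y, v} \<in> E" for u v
  proof -
    have V: "u \<in> V" "v \<in> V" using u v endpoints edge_in_V by auto
    note d = graph_dist_le_2D[OF connected V]
    have d0: "u \<noteq> v \<Longrightarrow> 1 \<le> graph_dist V E u v" using d(1) by fastforce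
    have d1: "u \<noteq> v \<Longrightarrow> {u, v} \<notin> E \<Longrightarrow> 2 \<le> graph_dist V E u v" using d(1,2) by fastforce
    consider "u = x" "v = y" | "u = x" "v = x" | "u = x" "v \<noteq> x" "v \<noteq> y" "{y, v} \<in> E"
      | "u = y" "v = y" | "u = y" "v = x" | "u = y" "v \<noteq> x" "v \<noteq> y"
      | "{x, u} \<in> E" "u \<noteq> x" "u \<noteq> y" "v = y" | "{x, u} \<in> E" "u \<noteq> x" "u \<noteq> y" "v = x"
      | "{x, u} \<in> E" "u \<noteq> x" "u \<noteq> y" "{y, v} \<in> E" "v \<noteq> x" "v \<noteq> y"
      using u v by blast
    then show ?thesis
      by cases (use d0 d1 far[of u v] no_triangle[of u] no_triangle[of v] endpoints(3) in
          \<open>auto simp: \<phi>_def \<psi>_def insert_commute\<close>)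
  qed
  have sum_\<phi>: "(\<Sum>u\<in>V. \<phi> u * step x u) = 2 * step x y - 1"
  proof -
    have "\<phi> u * step x u = 2 * (step x u * of_bool (u = y)) - step x u" for u
      using endpoints(3) by (auto simp: \<phi>_def step_self of_bool_def)
    then show ?thesis
      by (simp add: sum_subtractf sum_mult_of_bool_eq finite_V endpoints sum_step_x flip: sum_distrib_left)
  qed
  have sum_\<psi>: "(\<Sum>v\<in>V. \<psi> v * step y v) = 2 - 2 * step y x"
  proof -
    have "\<psi> v * step y v = 2 * step y v - 2 * (step y v * of_bool (v = x))" for v
      using endpoints(3) by (auto simp: \<psi>_def step_self of_bool_def)
    then show ?thesis
      by (simp add: sum_subtractf sum_mult_of_bool_eq finite_V endpoints sum_step_y flip: sum_distrib_left)
  qed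
  have W: "\<alpha> + (1 - \<alpha>) * (3 - 2 * edge_q V E w x y) \<le> lazy_wasserstein \<alpha>"
    if "0 \<le> \<alpha>" "\<alpha> < 1" for \<alpha>
  proof -
    have "\<alpha> * (\<psi> y - \<phi> x) + (1 - \<alpha>) * ((2 - 2 * step y x) - (2 * step x y - 1))
            \<le> lazy_wasserstein \<alpha>"
      using lazy_wasserstein_ge_dual[OF _ _ dual, of \<alpha>] that unfolding sum_\<phi> sum_\<psi> by simp
    moreover have "\<psi> y - \<phi> x = 1" by (simp add: \<phi>_def \<psi>_def)
    ultimately show ?thesis by (simp add: edge_q_eq algebra_simps)
  qed
  have "kappa_LLY V E w x y \<le> 2 * edge_q V E w x y - 2"
  proof (rule kappa_LLY_leI)
    fix \<alpha> :: real assume "0 \<le> \<alpha>" "\<alpha> < 1"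
    moreover from this have "kappa V E w \<alpha> x y \<le> (2 * edge_q V E w x y - 2) * (1 - \<alpha>)"
      using W[of \<alpha>] by (simp add: kappa_def algebra_simps)
    ultimately show "kappa V E w \<alpha> x y / (1 - \<alpha>) \<le> 2 * edge_q V E w x y - 2"
      by (simp add: pos_divide_le_eq)
  qed
  then show ?thesis by (simp add: short_cycle_surplus_def)
qed

lemma surplus_nonneg: "0 \<le> short_cycle_surplus V E w x y"
proof (rule surplus_ge)
  show "{x, y} \<in> E" "{y, x} \<in> E" using edge endpoints(4) by auto
  show "graph_dist V E y x \<le> 2" using graph_dist_edge[OF simple endpoints(4)] by simp
qed (auto intro: step_nonneg)

lemma surplus_pos:
  assumes "closing_pair V E x y a b"
  shows "0 < short_cycle_surplus V E w x y"
proof -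
  have ab: "{x, a} \<in> E" "{y, b} \<in> E" "a \<noteq> y" "b \<noteq> x" "graph_dist V E a b \<le> 2"
    using assms by (auto simp: closing_pair_def)
  then have pos: "0 < min (step x a) (step y b)" by (simp add: step_pos_iff)
  also have "\<dots> \<le> short_cycle_surplus V E w x y"
    by (rule surplus_ge[OF ab(1,2,5)]) (use pos ab in auto)
  finally show ?thesis .
qed

end

theorem lemma4p1:
  fixes V :: "'a set" and E :: "'a set set" and w :: "'a set \<Rightarrow> real"
    and e :: "'a set" and x y :: 'a
  assumes "simple_graph V E"
    and "connected_graph V E"
    and "\<forall>f\<in>E. 0 < w f"
    and "e \<in> E"
    and "e = {x, y}"
  shows "0 \<le> short_cycle_surplus V E w x y \<and>
         (short_cycle_surplus V E w x y = 0 \<longleftrightarrow> 6 \<le> local_girth E e)"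
proof -
  interpret weighted_edge V E w x y using assms by unfold_locales auto
  have "short_cycle_surplus V E w x y = 0 \<longleftrightarrow> (\<forall>a b. \<not> closing_pair V E x y a b)"
    using surplus_nonneg surplus_pos surplus_le_0 by (metis less_irrefl order_antisym)
  then show ?thesis
    using surplus_nonneg local_girth_ge_6_iff[OF simple connected edge] assms(5) by simp
qed

end
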